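(* Let $I$ be a residuated lattice. The following are equivalent: (1) $I$ is a simple WNM-algebra; (2) $I$ has a coatom $u$ and its operations are given by: $x\odot y=0$ if $x,y<1$, $x\odot y=x$ if $y=1$, $x\odot y=y$ if $x=1$; and $x\rightarrow y=1$ if $x\le y$, $x\rightarrow y=y$ if $x=1$, $x\rightarrow y=u$ if $y<x<1$.
   Context: A residuated lattice is an algebra $\langle A,\wedge,\vee,\odot,\rightarrow,0,1\rangle$ of type $\langle2,2,2,2,0,0\rangle$ such that $\langle A,\odot,1\rangle$ is a commutative monoid, $\langle A,\vee,\wedge,0,1\rangle$ is a bounded lattice (order $\le$), and $a\odot b\le c$ iff $a\le b\rightarrow c$. Put $\neg x=x\rightarrow0$. An MTL-algebra is a residuated lattice satisfying $(x\rightarrow y)\vee(y\rightarrow x)=1$; a WNM-algebra is an MTL-algebra satisfying $\neg(x\odot y)\vee((x\wedge y)\rightarrow(x\odot y))=1$. An algebra is simple if its only congruences are the diagonal and the total congruence. A coatom is an element $u<1$ such that there is no $x$ with $u<x<1$.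
   Formalization: Simple algebras are required to be nontrivial (the one-element algebra has no coatom), and in (2) the listed cases must cover all pairs x, y, so the order is total; otherwise 0<a,b<u<1 with a, b incomparable satisfies (2) but is not MTL. *)

theory Defs
  imports Main
begin

text \<open>The lattice bounds \<open>zero\<close>, \<open>one\<close> are the constants 0, 1 of the algebra. The order is the one
  carried by the class locale \<open>bounded_lattice\<close>, which determines it from the lattice operations.\<close>

locale residuated_lattice =
  bounded_lattice meet le lt join zero one + odot: comm_monoid odot one
  for meet :: "'a \<Rightarrow> 'a \<Rightarrow> 'a" (infixl "\<sqinter>" 70)
    and le :: "'a \<Rightarrow> 'a \<Rightarrow> bool" (infix "\<sqsubseteq>" 50)
    and lt :: "'a \<Rightarrow> 'a \<Rightarrow> bool" (infix "\<sqsubset>" 50)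
    and join :: "'a \<Rightarrow> 'a \<Rightarrow> 'a" (infixl "\<squnion>" 65)
    and odot :: "'a \<Rightarrow> 'a \<Rightarrow> 'a" (infixl "\<odot>" 75)
    and zero :: 'a ("\<zero>")
    and one :: 'a ("\<one>") +
  fixes imp :: "'a \<Rightarrow> 'a \<Rightarrow> 'a" (infixr "\<leadsto>" 60)
  assumes residuation: "a \<odot> b \<sqsubseteq> c \<longleftrightarrow> a \<sqsubseteq> b \<leadsto> c"
begin

abbreviation neg :: "'a \<Rightarrow> 'a" where
  "neg x \<equiv> x \<leadsto> \<zero>"

end

locale mtl_algebra = residuated_lattice +
  assumes prelinearity: "(x \<leadsto> y) \<squnion> (y \<leadsto> x) = \<one>"

locale wnm_algebra = mtl_algebra +
  assumes weak_nilpotent_minimum: "neg (x \<odot> y) \<squnion> ((x \<sqinter> y) \<leadsto> (x \<odot> y)) = \<one>"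

text \<open>Congruences of an algebra whose universe is the whole type and whose basic operations are the
  binary operations in \<open>F\<close>, together with any constants (every equivalence relation is compatible
  with constants).\<close>

definition congruence :: "('a \<Rightarrow> 'a \<Rightarrow> 'a) set \<Rightarrow> ('a \<times> 'a) set \<Rightarrow> bool" where
  "congruence F \<theta> \<longleftrightarrow> equiv UNIV \<theta> \<and>
     (\<forall>f\<in>F. \<forall>x x' y y'. (x, x') \<in> \<theta> \<longrightarrow> (y, y') \<in> \<theta> \<longrightarrow> (f x y, f x' y') \<in> \<theta>)"

text \<open>The diagonal and the total congruence are understood to be two different congruences, so the
  one-element algebra is not simple. It has no coatom, hence the characterization of simple
  WNM-algebras requires this convention.\<close>

definition simple_algebra :: "('a \<Rightarrow> 'a \<Rightarrow> 'a) set \<Rightarrow> bool" where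
  "simple_algebra F \<longleftrightarrow>
     (Id :: ('a \<times> 'a) set) \<noteq> UNIV \<and> (\<forall>\<theta>. congruence F \<theta> \<longrightarrow> \<theta> = Id \<or> \<theta> = UNIV)"

definition coatom :: "('a \<Rightarrow> 'a \<Rightarrow> bool) \<Rightarrow> 'a \<Rightarrow> 'a \<Rightarrow> bool" where
  "coatom lt one u \<longleftrightarrow> lt u one \<and> \<not> (\<exists>x. lt u x \<and> lt x one)"

text \<open>\<open>f\<close> is the operation given by a case distinction, listed as pairs of a condition and a value.
  A case distinction defines an operation only if its cases cover all arguments; this is the second
  conjunct. For the implication table with cases \<open>x \<le> y\<close>, \<open>x = 1\<close>, \<open>y < x < 1\<close> it says that the order
  is total. Without it, the lattice 0 < a, b < u < 1 with a, b incomparable and \<open>x \<odot> y = 0\<close> for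
  \<open>x, y < 1\<close> would satisfy the table although it is not an MTL-algebra.\<close>

definition given_by_cases ::
  "('a \<Rightarrow> 'a \<Rightarrow> 'a) \<Rightarrow> (('a \<Rightarrow> 'a \<Rightarrow> bool) \<times> ('a \<Rightarrow> 'a \<Rightarrow> 'a)) list \<Rightarrow> bool" where
  "given_by_cases f cs \<longleftrightarrow>
     (\<forall>(P, g)\<in>set cs. \<forall>x y. P x y \<longrightarrow> f x y = g x y) \<and>
     (\<forall>x y. \<exists>(P, g)\<in>set cs. P x y)"

end

theory Submission
  imports Defs
begin

text \<open>In a WNM-algebra every square is idempotent, since multiplying the WNM identity for \<open>y = x\<close> by
  \<open>x\<^sup>2\<close> gives \<open>x\<^sup>2 \<le> x\<^sup>3\<close>. An idempotent \<open>e\<close> induces the congruence that identifies \<open>a\<close> and \<open>b\<close> when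
  \<open>e \<odot> a \<le> b\<close> and \<open>e \<odot> b \<le> a\<close>, so by simplicity 0 and 1 are the only idempotents and every
  \<open>x < 1\<close> has \<open>x\<^sup>2 = 0\<close>. If \<open>c \<or> d = 1\<close> with \<open>c, d < 1\<close>, then multiplying by \<open>c\<close> and by \<open>d\<close> gives
  \<open>c = c \<odot> d = d\<close>, which is absurd; hence prelinearity makes the order total, and products below 1
  vanish. Residuation then shows that \<open>x \<rightarrow> y\<close> for \<open>y < x < 1\<close> is the greatest element below 1.
  Conversely, with the operations of the table, any congruence that identifies
  \<open>a < b\<close> identifies \<open>c = b \<rightarrow> a < 1\<close> with \<open>b \<rightarrow> b = 1\<close>, hence \<open>0 = c \<odot> c\<close> with 1.\<close>

lemma congruenceD:
  "congruence F \<theta> \<Longrightarrow> f \<in> F \<Longrightarrow> (x, x') \<in> \<theta> \<Longrightarrow> (y, y') \<in> \<theta> \<Longrightarrow> (f x y, f x' y') \<in> \<theta>"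
  by (simp add: congruence_def)

lemma given_by_three_cases:
  "given_by_cases f [(P, g), (Q, h), (R, k)] \<longleftrightarrow>
     (\<forall>x y. P x y \<longrightarrow> f x y = g x y) \<and> (\<forall>x y. Q x y \<longrightarrow> f x y = h x y) \<and>
     (\<forall>x y. R x y \<longrightarrow> f x y = k x y) \<and> (\<forall>x y. P x y \<or> Q x y \<or> R x y)"
  by (simp add: given_by_cases_def)

section \<open>Residuated lattices and the congruences induced by idempotents\<close>

context residuated_lattice
begin

lemma odot_mono_right: "b \<sqsubseteq> c \<Longrightarrow> a \<odot> b \<sqsubseteq> a \<odot> c"
  by (metis odot.commute order_refl order_trans residuation)

lemma odot_mono: "a \<sqsubseteq> b \<Longrightarrow> c \<sqsubseteq> d \<Longrightarrow> a \<odot> c \<sqsubseteq> b \<odot> d"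
  by (metis odot.commute odot_mono_right order_trans)

lemma odot_le_left: "a \<odot> b \<sqsubseteq> a"
  using odot_mono_right[of b \<one> a] by simp

lemma odot_le_right: "a \<odot> b \<sqsubseteq> b"
  using odot_le_left[of b a] by (simp add: odot.commute)

text \<open>By residuation, multiplication by \<open>a\<close> is a lower adjoint, so it preserves
  joins.\<close>

lemma odot_join_distrib: "a \<odot> (b \<squnion> c) = a \<odot> b \<squnion> a \<odot> c"
proof (rule order.antisym)
  have "b \<squnion> c \<sqsubseteq> a \<leadsto> (a \<odot> b \<squnion> a \<odot> c)"
    by (metis le_sup_iff odot.commute residuation sup_ge1 sup_ge2)
  then show "a \<odot> (b \<squnion> c) \<sqsubseteq> a \<odot> b \<squnion> a \<odot> c"
    by (metis odot.commute residuation)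
  show "a \<odot> b \<squnion> a \<odot> c \<sqsubseteq> a \<odot> (b \<squnion> c)"
    by (simp add: odot_mono_right)
qed

lemma modus_ponens: "(a \<leadsto> b) \<odot> a \<sqsubseteq> b"
  by (simp add: residuation)

lemma imp_eq_one_iff: "a \<leadsto> b = \<one> \<longleftrightarrow> a \<sqsubseteq> b"
  by (metis odot.left_neutral residuation top_le top_greatest)

text \<open>By residuation, membership says that \<open>e\<close> lies below both
  \<open>a \<leadsto> b\<close> and \<open>b \<leadsto> a\<close>: for idempotent \<open>e\<close>
  this is the congruence of the filter of all elements above \<open>e\<close>.\<close>

definition idem_cong :: "'a \<Rightarrow> ('a \<times> 'a) set" where
  "idem_cong e = {(a, b). e \<odot> a \<sqsubseteq> b \<and> e \<odot> b \<sqsubseteq> a}"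

lemma congruence_idem_cong:
  assumes idem: "e \<odot> e = e"
  shows "congruence {(\<sqinter>), (\<squnion>), (\<odot>), (\<leadsto>)} (idem_cong e)"
proof -
  \<comment> \<open>Idempotence allows \<open>e\<close> to be duplicated, so each of two chained or
    combined inequalities can consume its own copy.\<close>
  have twice: "e \<odot> (e \<odot> a) = e \<odot> a" for a
    by (metis idem odot.assoc)
  have trans: "e \<odot> a \<sqsubseteq> c" if "e \<odot> a \<sqsubseteq> b" "e \<odot> b \<sqsubseteq> c" for a b c
    using that by (metis odot_mono_right order_trans twice)
  have meet: "e \<odot> (a \<sqinter> b) \<sqsubseteq> a'" "e \<odot> (b \<sqinter> a) \<sqsubseteq> a'" if "e \<odot> a \<sqsubseteq> a'" for a b a'
    using that by (meson inf_le1 inf_le2 odot_mono_right order_trans)+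
  have join: "e \<odot> (a \<squnion> b) \<sqsubseteq> a' \<squnion> b'" if "e \<odot> a \<sqsubseteq> a'" "e \<odot> b \<sqsubseteq> b'" for a b a' b'
    using that by (simp add: odot_join_distrib le_supI1 le_supI2)
  have odot: "e \<odot> (a \<odot> b) \<sqsubseteq> a' \<odot> b'" if "e \<odot> a \<sqsubseteq> a'" "e \<odot> b \<sqsubseteq> b'" for a b a' b'
  proof -
    have "(e \<odot> a) \<odot> (e \<odot> b) = (e \<odot> e) \<odot> (a \<odot> b)"
      by (simp only: odot.assoc odot.commute odot.left_commute)
    then show ?thesis
      using odot_mono[OF that] by (simp only: idem)
  qed
  \<comment> \<open>The first argument is contravariant, hence the reversed first hypothesis. One
    copy of \<open>e\<close> turns \<open>a'\<close> into \<open>a\<close>, the other turns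
    \<open>b\<close> into \<open>b'\<close>.\<close>
  have imp: "e \<odot> (a \<leadsto> b) \<sqsubseteq> a' \<leadsto> b'" if "e \<odot> a' \<sqsubseteq> a" "e \<odot> b \<sqsubseteq> b'" for a b a' b'
  proof -
    have "e \<odot> (a \<leadsto> b) \<odot> a' = e \<odot> ((a \<leadsto> b) \<odot> (e \<odot> a'))"
      by (metis odot.assoc odot.left_commute twice)
    also have "\<dots> \<sqsubseteq> e \<odot> ((a \<leadsto> b) \<odot> a)"
      by (intro odot_mono_right that)
    also have "\<dots> \<sqsubseteq> e \<odot> b"
      by (intro odot_mono_right modus_ponens)
    also have "\<dots> \<sqsubseteq> b'"
      by fact
    finally show ?thesis
      by (simp add: residuation)
  qed
  have "equiv UNIV (idem_cong e)"
    by (rule equivI)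
      (auto simp: idem_cong_def odot_le_right intro!: refl_onI symI transI intro: trans)
  then show ?thesis
    by (auto simp: congruence_def idem_cong_def intro: meet join odot imp)
qed

text \<open>Meeting both sides of the pair with \<open>x\<close> puts every \<open>x\<close> into
  the class of \<open>\<zero>\<close>.\<close>

lemma congruence_eq_UNIV:
  assumes cong: "congruence {(\<sqinter>), (\<squnion>), (\<odot>), (\<leadsto>)} \<theta>" and "(\<zero>, \<one>) \<in> \<theta>"
  shows "\<theta> = UNIV"
proof -
  have eq: "equiv UNIV \<theta>"
    using cong by (simp add: congruence_def)
  have "(x, x) \<in> \<theta>" for x
    using eq by (simp add: equiv_def refl_on_def)
  then have "(\<zero> \<sqinter> x, \<one> \<sqinter> x) \<in> \<theta>" for x
    using assms(2) by (intro congruenceD[OF cong, of "(\<sqinter>)"]) simp_all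
  then have zero: "(\<zero>, x) \<in> \<theta>" for x
    by simp
  then have "(x, y) \<in> \<theta>" for x y
    using eq by (meson equiv_def symD transD)
  then show ?thesis
    by auto
qed

lemma simple_idempotent:
  assumes "simple_algebra {(\<sqinter>), (\<squnion>), (\<odot>), (\<leadsto>)}" and "e \<odot> e = e"
  shows "e = \<zero> \<or> e = \<one>"
proof -
  consider "idem_cong e = Id" | "idem_cong e = UNIV"
    using assms congruence_idem_cong by (auto simp: simple_algebra_def)
  then show ?thesis
  proof cases
    case 1
    have "(e, \<one>) \<in> idem_cong e"
      by (simp add: idem_cong_def)
    with 1 show ?thesis
      by simp
  next
    case 2
    then have "(\<one>, \<zero>) \<in> idem_cong e"
      by simp
    then show ?thesis
      by (simp add: idem_cong_def bot_unique)
  qed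
qed

text \<open>The product lies below the square of the larger factor.\<close>

lemma mult_below_one:
  assumes sq: "\<And>x. x \<noteq> \<one> \<Longrightarrow> x \<odot> x = \<zero>" and total: "\<And>x y. x \<sqsubseteq> y \<or> y \<sqsubseteq> x"
    and "x \<noteq> \<one>" "y \<noteq> \<one>"
  shows "x \<odot> y = \<zero>"
  using total[of x y] assms(3,4) by (metis sq bot_unique odot.commute odot_mono_right)

end

section \<open>Simple WNM-algebras: squares, total order and coatom\<close>

context wnm_algebra
begin

lemma square_idempotent: "(x \<odot> x) \<odot> (x \<odot> x) = x \<odot> x"
proof -
  let ?e = "x \<odot> x"
  have "?e = ?e \<odot> (neg ?e \<squnion> (x \<leadsto> ?e))"
    using weak_nilpotent_minimum[of x x] by simp
  also have "\<dots> = neg ?e \<odot> ?e \<squnion> ((x \<leadsto> ?e) \<odot> x) \<odot> x"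
    by (simp add: odot_join_distrib odot.commute odot.left_commute odot.assoc)
  also have "\<dots> \<sqsubseteq> \<zero> \<squnion> ?e \<odot> x"
    by (intro sup_mono modus_ponens odot_mono order_refl)
  finally have "?e \<sqsubseteq> ?e \<odot> x"
    by simp
  then have "?e = ?e \<odot> x"
    by (rule order.antisym) (rule odot_le_left)
  \<comment> \<open>Since the cube equals the square, so does the fourth power.\<close>
  then show ?thesis
    by (metis odot.assoc)
qed

context
  assumes simple: "simple_algebra {(\<sqinter>), (\<squnion>), (\<odot>), (\<leadsto>)}"
begin

text \<open>The square is an idempotent below \<open>x\<close>, so it cannot be
  \<open>\<one>\<close>.\<close>

lemma square_eq_zero: "x \<noteq> \<one> \<Longrightarrow> x \<odot> x = \<zero>"
  using simple_idempotent[OF simple square_idempotent[of x]] odot_le_left[of x x]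
  by (metis top_le)

lemma total_order: "x \<sqsubseteq> y \<or> y \<sqsubseteq> x"
proof -
  let ?c = "x \<leadsto> y" and ?d = "y \<leadsto> x"
  have "?c = \<one> \<or> ?d = \<one>"
  proof (rule ccontr)
    assume ne: "\<not> ?thesis"
    \<comment> \<open>Distributing leaves only the mixed product, because both squares
      vanish.\<close>
    have "?c \<odot> (?c \<squnion> ?d) = ?c \<odot> ?d" "?d \<odot> (?c \<squnion> ?d) = ?c \<odot> ?d"
      using ne by (simp_all add: odot_join_distrib square_eq_zero odot.commute[of ?d ?c])
    then have "?c = ?c \<odot> ?d" "?d = ?c \<odot> ?d"
      by (simp_all only: prelinearity odot.right_neutral)
    then have "?c = ?d"
      by (rule trans[OF _ sym])
    then show False
      using ne prelinearity[of x y] by simp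
  qed
  then show ?thesis
    by (simp add: imp_eq_one_iff)
qed

lemma odot_below_one: "x \<noteq> \<one> \<Longrightarrow> y \<noteq> \<one> \<Longrightarrow> x \<odot> y = \<zero>"
  by (rule mult_below_one[OF square_eq_zero total_order])

lemma imp_greatest_below_one:
  assumes "y \<sqsubset> x" "x \<sqsubset> \<one>"
  shows "x \<leadsto> y \<sqsubset> \<one>" and "z \<sqsubset> \<one> \<Longrightarrow> z \<sqsubseteq> x \<leadsto> y"
proof -
  show "x \<leadsto> y \<sqsubset> \<one>"
    using assms by (metis imp_eq_one_iff leD less_top)
  assume "z \<sqsubset> \<one>"
  then have "z \<odot> x = \<zero>"
    using assms by (intro odot_below_one) auto
  then show "z \<sqsubseteq> x \<leadsto> y"
    by (metis bot_least residuation)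
qed

lemma coatom_exists: "\<exists>u. coatom (\<sqsubset>) \<one> u \<and> (\<forall>x y. y \<sqsubset> x \<and> x \<sqsubset> \<one> \<longrightarrow> x \<leadsto> y = u)"
proof (cases "\<exists>x y. y \<sqsubset> x \<and> x \<sqsubset> \<one>")
  case True
  then obtain x y where xy: "y \<sqsubset> x" "x \<sqsubset> \<one>"
    by auto
  have "coatom (\<sqsubset>) \<one> (x \<leadsto> y)"
    using imp_greatest_below_one[OF xy] by (auto simp: coatom_def dest: leD)
  moreover have "x' \<leadsto> y' = x \<leadsto> y" if "y' \<sqsubset> x'" "x' \<sqsubset> \<one>" for x' y'
    using imp_greatest_below_one[OF xy] imp_greatest_below_one[OF that]
    by (simp add: order.antisym)
  ultimately show ?thesis
    by blast
next
  \<comment> \<open>Nothing lies strictly between the bounds here, so \<open>\<zero>\<close> serves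
    as the coatom and the condition on implications is vacuous.\<close>
  case False
  have "\<zero> \<noteq> \<one>"
  proof
    assume "\<zero> = \<one>"
    \<comment> \<open>Equal bounds collapse the algebra to one element, which the convention on
      simplicity excludes.\<close>
    then have "x = y" for x y :: 'a
      by (metis bot_least top_le)
    then show False
      using simple by (auto simp: simple_algebra_def)
  qed
  then have "coatom (\<sqsubset>) \<one> \<zero>"
    using False by (auto simp: coatom_def less_top)
  with False show ?thesis
    by blast
qed

end

end

section \<open>Algebras whose operations are given by the tables\<close>

context residuated_lattice
begin

lemma wnm_algebra_of_tables:
  assumes total: "\<And>x y. x \<sqsubseteq> y \<or> y \<sqsubseteq> x"
    and zero: "\<And>x y. x \<sqsubset> \<one> \<Longrightarrow> y \<sqsubset> \<one> \<Longrightarrow> x \<odot> y = \<zero>"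
  shows "wnm_algebra (\<sqinter>) (\<sqsubseteq>) (\<sqsubset>) (\<squnion>) (\<odot>) \<zero> \<one> (\<leadsto>)"
proof
  show "(x \<leadsto> y) \<squnion> (y \<leadsto> x) = \<one>" for x y
    using total[of x y] by (metis imp_eq_one_iff sup_top_left sup_top_right)
  show "neg (x \<odot> y) \<squnion> (x \<sqinter> y \<leadsto> x \<odot> y) = \<one>" for x y
  proof -
    \<comment> \<open>If a factor is \<open>\<one>\<close>, product and meet agree and the second
      joinand is \<open>\<one>\<close>; if the product is \<open>\<zero>\<close>, its negation is
      \<open>\<one>\<close>.\<close>
    consider "x = \<one>" | "y = \<one>" | "x \<odot> y = \<zero>"
      using zero less_top by blast
    then show ?thesis
      by cases (simp_all add: imp_eq_one_iff[THEN iffD2])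
  qed
qed

lemma simple_of_tables:
  assumes total: "\<And>x y. x \<sqsubseteq> y \<or> y \<sqsubseteq> x"
    and zero: "\<And>x y. x \<sqsubset> \<one> \<Longrightarrow> y \<sqsubset> \<one> \<Longrightarrow> x \<odot> y = \<zero>"
    and "\<zero> \<noteq> \<one>"
  shows "simple_algebra {(\<sqinter>), (\<squnion>), (\<odot>), (\<leadsto>)}"
  unfolding simple_algebra_def
proof (intro conjI allI impI)
  show "(Id :: ('a \<times> 'a) set) \<noteq> UNIV"
    using \<open>\<zero> \<noteq> \<one>\<close> by (metis (full_types) UNIV_I pair_in_Id_conv)
  fix \<theta> assume cong: "congruence {(\<sqinter>), (\<squnion>), (\<odot>), (\<leadsto>)} \<theta>"
  then have eq: "equiv UNIV \<theta>"
    by (simp add: congruence_def)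
  then have refl: "(x, x) \<in> \<theta>" for x
    by (simp add: equiv_def refl_on_def)
  have sym: "(y, x) \<in> \<theta>" if "(x, y) \<in> \<theta>" for x y
    using eq that by (meson equiv_def symD)
  have univ: "\<theta> = UNIV" if ab: "(a, b) \<in> \<theta>" "a \<sqsubset> b" for a b
  proof -
    let ?c = "b \<leadsto> a"
    have "(b \<leadsto> a, b \<leadsto> b) \<in> \<theta>"
      using congruenceD[OF cong, of "(\<leadsto>)"] ab refl by simp
    then have c: "(?c, \<one>) \<in> \<theta>"
      using imp_eq_one_iff[of b b] by simp
    then have "(?c \<odot> ?c, \<one> \<odot> \<one>) \<in> \<theta>"
      by (intro congruenceD[OF cong, of "(\<odot>)"]) simp
    \<comment> \<open>As \<open>b\<close> is not below \<open>a\<close>, the residuum is a proper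
      element, so its square is \<open>\<zero>\<close> and the pair above becomes
      \<open>(\<zero>, \<one>)\<close>.\<close>
    moreover have "?c \<sqsubset> \<one>"
      using ab(2) imp_eq_one_iff[of b a] by (metis leD less_top)
    ultimately show ?thesis
      using cong by (auto intro!: congruence_eq_UNIV simp: zero)
  qed
  show "\<theta> = Id \<or> \<theta> = UNIV"
  proof (rule ccontr)
    assume ne: "\<not> ?thesis"
    then obtain a b where "(a, b) \<in> \<theta>" "a \<noteq> b"
      using refl by auto
    \<comment> \<open>Totality makes the distinct elements comparable, and symmetry of
      \<open>\<theta>\<close> lets the smaller one come first.\<close>
    then show False
      using univ[of a b] univ[of b a] sym total[of a b] ne by (auto simp: less_le)
  qed
qed

end

theorem theorem8p2:
  fixes meet :: "'a \<Rightarrow> 'a \<Rightarrow> 'a" (infixl "\<sqinter>" 70)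
    and le :: "'a \<Rightarrow> 'a \<Rightarrow> bool" (infix "\<sqsubseteq>" 50)
    and lt :: "'a \<Rightarrow> 'a \<Rightarrow> bool" (infix "\<sqsubset>" 50)
    and join :: "'a \<Rightarrow> 'a \<Rightarrow> 'a" (infixl "\<squnion>" 65)
    and odot :: "'a \<Rightarrow> 'a \<Rightarrow> 'a" (infixl "\<odot>" 75)
    and imp :: "'a \<Rightarrow> 'a \<Rightarrow> 'a" (infixr "\<leadsto>" 60)
    and zero :: 'a ("\<zero>")
    and one :: 'a ("\<one>")
  assumes "residuated_lattice (\<sqinter>) (\<sqsubseteq>) (\<sqsubset>) (\<squnion>) (\<odot>) \<zero> \<one> (\<leadsto>)"
  shows "(wnm_algebra (\<sqinter>) (\<sqsubseteq>) (\<sqsubset>) (\<squnion>) (\<odot>) \<zero> \<one> (\<leadsto>) \<and>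
          simple_algebra {(\<sqinter>), (\<squnion>), (\<odot>), (\<leadsto>)})
     \<longleftrightarrow> (\<exists>u. coatom (\<sqsubset>) \<one> u \<and>
            given_by_cases (\<odot>)
              [(\<lambda>x y. x \<sqsubset> \<one> \<and> y \<sqsubset> \<one>, \<lambda>x y. \<zero>),
               (\<lambda>x y. y = \<one>, \<lambda>x y. x),
               (\<lambda>x y. x = \<one>, \<lambda>x y. y)] \<and>
            given_by_cases (\<leadsto>)
              [(\<lambda>x y. x \<sqsubseteq> y, \<lambda>x y. \<one>),
               (\<lambda>x y. x = \<one>, \<lambda>x y. y),
               (\<lambda>x y. y \<sqsubset> x \<and> x \<sqsubset> \<one>, \<lambda>x y. u)])"
proof -
  interpret residuated_lattice "(\<sqinter>)" "(\<sqsubseteq>)" "(\<sqsubset>)" "(\<squnion>)" "(\<odot>)" \<zero> \<one> "(\<leadsto>)"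
    by fact
  show ?thesis (is "?simple \<longleftrightarrow> (\<exists>u. ?tables u)")
  proof
    assume ?simple
    then interpret wnm_algebra "(\<sqinter>)" "(\<sqsubseteq>)" "(\<sqsubset>)" "(\<squnion>)" "(\<odot>)" \<zero> \<one> "(\<leadsto>)"
      by blast
    have simple: "simple_algebra {(\<sqinter>), (\<squnion>), (\<odot>), (\<leadsto>)}"
      using \<open>?simple\<close> ..
    obtain u where u: "coatom (\<sqsubset>) \<one> u" "\<And>x y. y \<sqsubset> x \<and> x \<sqsubset> \<one> \<Longrightarrow> x \<leadsto> y = u"
      using coatom_exists[OF simple] by blast
    have one_imp: "\<one> \<leadsto> y = y" for y
    proof (rule order.antisym)
      show "\<one> \<leadsto> y \<sqsubseteq> y"
        using modus_ponens[of \<one> y] by simp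
      show "y \<sqsubseteq> \<one> \<leadsto> y"
        by (simp flip: residuation)
    qed
    have total: "x \<sqsubseteq> y \<or> x = \<one> \<or> y \<sqsubset> x \<and> x \<sqsubset> \<one>" for x y
      using total_order[OF simple, of x y] by (metis less_le top_greatest)
    have below: "x \<sqsubset> \<one> \<longleftrightarrow> x \<noteq> \<one>" for x
      using less_top by blast
    show "\<exists>u. ?tables u"
      unfolding given_by_three_cases
    proof (rule exI[of _ u], intro conjI allI impI)
      show "coatom (\<sqsubset>) \<one> u"
        by (fact u(1))
      show "x \<odot> y = \<zero>" if "x \<sqsubset> \<one> \<and> y \<sqsubset> \<one>" for x y
        using that unfolding below by (intro odot_below_one[OF simple]) blast+
      show "x \<odot> y = x" if "y = \<one>" for x y
        using that by simp
      show "x \<odot> y = y" if "x = \<one>" for x y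
        using that by simp
      show "x \<sqsubset> \<one> \<and> y \<sqsubset> \<one> \<or> y = \<one> \<or> x = \<one>" for x y
        unfolding below by blast
      show "x \<leadsto> y = \<one>" if "x \<sqsubseteq> y" for x y
        using that by (simp only: imp_eq_one_iff)
      show "x \<leadsto> y = y" if "x = \<one>" for x y
        unfolding that by (fact one_imp)
      show "x \<leadsto> y = u" if "y \<sqsubset> x \<and> x \<sqsubset> \<one>" for x y
        using that by (fact u(2))
      show "x \<sqsubseteq> y \<or> x = \<one> \<or> y \<sqsubset> x \<and> x \<sqsubset> \<one>" for x y
        by (fact total)
    qed
  next
    assume "\<exists>u. ?tables u"
    then obtain u where tables: "?tables u" ..
    then have u: "u \<sqsubset> \<one>"
      by (simp only: coatom_def)
    have zero: "x \<odot> y = \<zero>" if "x \<sqsubset> \<one>" "y \<sqsubset> \<one>" for x y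
      using tables that by (simp only: given_by_three_cases)
    \<comment> \<open>The covering condition of the implication table is the source of the total
      order.\<close>
    have cases: "x \<sqsubseteq> y \<or> x = \<one> \<or> y \<sqsubset> x \<and> x \<sqsubset> \<one>" for x y
      using tables by (simp only: given_by_three_cases)
    \<comment> \<open>With equal bounds the coatom would lie strictly below
      \<open>\<zero>\<close>.\<close>
    have ne: "\<zero> \<noteq> \<one>"
      using u by (metis not_less_bot)
    have total: "x \<sqsubseteq> y \<or> y \<sqsubseteq> x" for x y
      using cases[of x y] by auto
    show ?simple
      using wnm_algebra_of_tables[OF total zero] simple_of_tables[OF total zero ne] by blast
  qed
qed

end
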